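(* Let $\pi$ be a cohereditary graph property that can be characterized by finitely many obligatory subgraphs, i.e., there is a finite set $\mathcal{S}$ of graphs such that a graph $G$ has $\pi$ if and only if some graph in $\mathcal{S}$ is an induced subgraph of $G$. Then there is an optimal (i.e., $1$-competitive) online algorithm with advice for $\textsc{Min-}\pi$ that reads $O(\log n)$ bits of advice on inputs of length $n$.
   Context: A graph property is cohereditary if whenever a graph $G$ has it and $G$ is an induced subgraph of $G'$, then $G'$ also has it. Online vertex-arrival model: an input is a graph $G$ with vertices $v_1,\dots,v_n$ presented one at a time; when $v_i$ is presented, all edges $\{v_j,v_i\}$ with $j<i$ are revealed; neither $G$ nor $n$ is known in advance. In $\textsc{Min-}\pi$, upon arrival of each vertex the algorithm irrevocably decides whether to accept it; if $S$ is the set of accepted vertices, the cost is $|S|$ if the induced subgraph $G[S]$ has property $\pi$ and $\infty$ otherwise; the goal is to minimize cost. Advice model: the algorithm has access to an infinite binary advice string $\phi$ (chosen with knowledge of the whole input), and its decision at step $i$ may depend on $\phi$ and the vertices seen so far. An algorithm is optimal with advice complexity $b(n)$ if for every $n$ and every input $I$ of length at most $n$ there exists $\phi$ such that its cost on $I$ with advice $\phi$ equals the optimal cost on $I$ and at most the first $b(n)$ bits of $\phi$ are read. *)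

theory Defs
  imports "HOL-Library.Extended_Nat" "HOL-Library.Landau_Symbols"
begin

record 'v graph =
  verts :: "'v set"
  edges :: "'v set set"

definition simple_graph :: "'v graph \<Rightarrow> bool" where
  "simple_graph G \<longleftrightarrow> finite (verts G) \<and> (\<forall>e \<in> edges G. e \<subseteq> verts G \<and> card e = 2)"

definition induce :: "'v graph \<Rightarrow> 'v set \<Rightarrow> 'v graph" where
  "induce G W = \<lparr>verts = W, edges = {e \<in> edges G. e \<subseteq> W}\<rparr>"

definition isomorphic :: "'v graph \<Rightarrow> 'v graph \<Rightarrow> bool" where
  "isomorphic G H \<longleftrightarrow>
     (\<exists>f. bij_betw f (verts G) (verts H) \<and>
          (\<forall>u \<in> verts G. \<forall>v \<in> verts G. {u, v} \<in> edges G \<longleftrightarrow> {f u, f v} \<in> edges H))"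

text \<open>Containment is up to isomorphism, so a cohereditary property in the sense below is
  automatically invariant under isomorphism. All graphs of one statement share the vertex type
  \<open>'v\<close>; any infinite type, such as \<^typ>\<open>nat\<close>, realises every finite graph up to isomorphism.\<close>

definition induced_subgraph_of :: "'v graph \<Rightarrow> 'v graph \<Rightarrow> bool" where
  "induced_subgraph_of H G \<longleftrightarrow> (\<exists>W \<subseteq> verts G. isomorphic H (induce G W))"

definition cohereditary :: "('v graph \<Rightarrow> bool) \<Rightarrow> bool" where
  "cohereditary \<pi> \<longleftrightarrow>
     (\<forall>G G'. simple_graph G \<and> simple_graph G' \<and> \<pi> G \<and> induced_subgraph_of G G' \<longrightarrow> \<pi> G')"

definition obligatory_subgraphs :: "'v graph set \<Rightarrow> ('v graph \<Rightarrow> bool) \<Rightarrow> bool" where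
  "obligatory_subgraphs \<S> \<pi> \<longleftrightarrow>
     (\<forall>H \<in> \<S>. simple_graph H) \<and>
     (\<forall>G. simple_graph G \<longrightarrow> (\<pi> G \<longleftrightarrow> (\<exists>H \<in> \<S>. induced_subgraph_of H G)))"

text \<open>An online input is a graph together with the order in which its vertices arrive.\<close>

type_synonym 'v online_input = "'v graph \<times> 'v list"

definition valid_input :: "'v online_input \<Rightarrow> bool" where
  "valid_input I \<longleftrightarrow> simple_graph (fst I) \<and> distinct (snd I) \<and> set (snd I) = verts (fst I)"

definition input_length :: "'v online_input \<Rightarrow> nat" where
  "input_length I = length (snd I)"

definition revealed :: "'v online_input \<Rightarrow> nat \<Rightarrow> 'v online_input" where
  "revealed I i = (induce (fst I) (set (take i (snd I))), take i (snd I))"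

type_synonym advice = "nat \<Rightarrow> bool"

text \<open>The computation of a single online decision: \<open>Read k s t\<close> reads bit \<open>k\<close> (counting from
  \<open>0\<close>) of the advice and continues with \<open>s\<close> if it is set and with \<open>t\<close> otherwise. Being a datatype,
  it reads only finitely many bits, whatever the advice.\<close>

datatype decision = Decide bool | Read nat decision decision

primrec outcome :: "decision \<Rightarrow> advice \<Rightarrow> bool" where
  "outcome (Decide a) \<phi> = a"
| "outcome (Read k s t) \<phi> = (if \<phi> k then outcome s \<phi> else outcome t \<phi>)"

primrec positions_read :: "decision \<Rightarrow> advice \<Rightarrow> nat set" where
  "positions_read (Decide a) \<phi> = {}"
| "positions_read (Read k s t) \<phi> =
     insert k (if \<phi> k then positions_read s \<phi> else positions_read t \<phi>)"

text \<open>When a vertex arrives, the algorithm is given the revealed part of the input, whose last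
  vertex is the new one. Memory of earlier steps need not be modelled: the earlier revealed parts
  can be recovered from the current one, and the advice can be read again.\<close>

type_synonym 'v algorithm = "'v online_input \<Rightarrow> decision"

definition accepted :: "'v algorithm \<Rightarrow> advice \<Rightarrow> 'v online_input \<Rightarrow> 'v set" where
  "accepted A \<phi> I =
     {snd I ! i | i. i < input_length I \<and> outcome (A (revealed I (Suc i))) \<phi>}"

definition advice_read :: "'v algorithm \<Rightarrow> advice \<Rightarrow> 'v online_input \<Rightarrow> nat set" where
  "advice_read A \<phi> I = (\<Union>i < input_length I. positions_read (A (revealed I (Suc i))) \<phi>)"

definition min_cost :: "('v graph \<Rightarrow> bool) \<Rightarrow> 'v graph \<Rightarrow> 'v set \<Rightarrow> enat" where
  "min_cost \<pi> G W = (if \<pi> (induce G W) then enat (card W) else \<infinity>)"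

definition opt_cost :: "('v graph \<Rightarrow> bool) \<Rightarrow> 'v graph \<Rightarrow> enat" where
  "opt_cost \<pi> G = (INF W \<in> Pow (verts G). min_cost \<pi> G W)"

definition optimal_with_advice ::
  "('v graph \<Rightarrow> bool) \<Rightarrow> 'v algorithm \<Rightarrow> (nat \<Rightarrow> nat) \<Rightarrow> bool" where
  "optimal_with_advice \<pi> A b \<longleftrightarrow>
     (\<forall>n I. valid_input I \<and> input_length I \<le> n \<longrightarrow>
        (\<exists>\<phi>. min_cost \<pi> (fst I) (accepted A \<phi> I) = opt_cost \<pi> (fst I) \<and>
             advice_read A \<phi> I \<subseteq> {..<b n}))"

end

theory Submission
  imports Defs "HOL-Library.Log_Nat" "HOL-Real_Asymp.Real_Asymp"
begin

text \<open>A minimal vertex set having the property is a copy of an obligatory subgraph, so it has at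
  most \<open>m\<close> elements for a constant \<open>m\<close>, and the advice consists of the arrival positions of its
  members. Since \<open>n\<close> is unknown to the algorithm, each position \<open>a\<close> is stored as two interleaved
  streams: its binary digits and the answers to \<open>a < 2 ^ t\<close> for all \<open>t\<close>. At step \<open>i < 2 ^ L\<close> the
  question \<open>a = i\<close> is settled by the answer to \<open>a < 2 ^ L\<close> and the lowest \<open>L\<close> digits, so only
  logarithmically many bits are read.\<close>

section \<open>Small optimal solutions\<close>

lemma induce_induce: "W \<subseteq> V \<Longrightarrow> induce (induce G V) W = induce G W"
  by (auto simp: induce_def)

lemma induce_verts_induce [simp]: "verts (induce G W) = W"
  by (simp add: induce_def)

lemma simple_graph_induce: "simple_graph G \<Longrightarrow> W \<subseteq> verts G \<Longrightarrow> simple_graph (induce G W)"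
  by (auto simp: simple_graph_def induce_def intro: finite_subset)

lemma isomorphic_card: "isomorphic G H \<Longrightarrow> card (verts G) = card (verts H)"
  by (auto simp: isomorphic_def dest: bij_betw_same_card)

text \<open>An obligatory graph embedded in \<open>induce G W\<close> occupies some U \<subseteq> W.
  As \<open>induce G U\<close> is itself a copy of that graph, it again has \<pi>.\<close>

lemma obligatory_core:
  assumes S: "obligatory_subgraphs \<S> \<pi>" and G: "simple_graph G"
    and W: "W \<subseteq> verts G" "\<pi> (induce G W)"
  obtains H U where "H \<in> \<S>" "U \<subseteq> W" "\<pi> (induce G U)" "card U = card (verts H)"
proof -
  obtain H U where H: "H \<in> \<S>" and U: "U \<subseteq> W" and iso: "isomorphic H (induce G U)"
    using S W simple_graph_induce[OF G W(1)]
    by (auto simp: obligatory_subgraphs_def induced_subgraph_of_def induce_induce)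
  have "induced_subgraph_of H (induce G U)"
    unfolding induced_subgraph_of_def using iso
    by (intro exI[of _ U]) (simp add: induce_induce)
  moreover have "simple_graph (induce G U)"
    using G U W by (intro simple_graph_induce) auto
  ultimately have "\<pi> (induce G U)"
    using S H by (auto simp: obligatory_subgraphs_def)
  with H U isomorphic_card[OF iso] show thesis
    using that[of H U] by simp
qed

lemma small_optimum:
  assumes S: "obligatory_subgraphs \<S> \<pi>" and m: "\<And>H. H \<in> \<S> \<Longrightarrow> card (verts H) \<le> m"
    and G: "simple_graph G"
  obtains W where "W \<subseteq> verts G" "card W \<le> m" "min_cost \<pi> G W = opt_cost \<pi> G"
proof -
  have fin: "finite (verts G)"
    using G by (simp add: simple_graph_def)
  let ?C = "min_cost \<pi> G ` Pow (verts G)"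
  \<comment> \<open>There are finitely many vertex sets, so the infimum is attained.\<close>
  have "Inf ?C \<in> ?C"
    using fin by (subst Min_Inf[symmetric]) (auto intro!: Min_in)
  then obtain V where V: "V \<subseteq> verts G" "opt_cost \<pi> G = min_cost \<pi> G V"
    by (auto simp: opt_cost_def)
  have opt_le: "opt_cost \<pi> G \<le> min_cost \<pi> G W" if "W \<subseteq> verts G" for W
    unfolding opt_cost_def using that by (intro INF_lower) auto
  show thesis
  proof (cases "\<pi> (induce G V)")
    case True
    then obtain H U where U: "H \<in> \<S>" "U \<subseteq> V" "\<pi> (induce G U)" "card U = card (verts H)"
      using obligatory_core[OF S G V(1)] by metis
    have "card U \<le> card V"
      using U V fin by (meson card_mono finite_subset)
    then have "min_cost \<pi> G U \<le> opt_cost \<pi> G"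
      using U V True by (simp add: min_cost_def)
    with opt_le[of U] U V m show thesis
      by (intro that[of U]) (auto intro: antisym)
  next
    \<comment> \<open>The optimum is \<infinity> here, so every vertex set has cost \<infinity> and
      the empty one will do.\<close>
    case False
    with V opt_le[of "{}"] show thesis
      by (intro that[of "{}"]) (auto simp: min_cost_def)
  qed
qed

text \<open>Lets the advice always hold exactly \<open>m\<close> positions, even when the solution
  is smaller.\<close>

lemma enumerate_padded:
  fixes P :: "nat set"
  assumes "P \<subseteq> {..<n}" "card P \<le> m"
  obtains p :: "nat \<Rightarrow> nat" where "\<And>i. i < n \<Longrightarrow> i \<in> P \<longleftrightarrow> (\<exists>j<m. p j = i)"
proof -
  have "finite P"
    using assms(1) finite_subset by blast
  then obtain h where "bij_betw h {0..<card P} P"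
    using ex_bij_betw_nat_finite by blast
  then have h: "P = h ` {0..<card P}"
    by (simp add: bij_betw_def)
  show thesis
  proof (rule that)
    fix i assume "i < n"
    then show "i \<in> P \<longleftrightarrow> (\<exists>j<m. (if j < card P then h j else n) = i)"
      using assms(2) by (subst h) (force simp: image_iff)
  qed
qed

section \<open>Testing stored positions\<close>

text \<open>The first mismatch falls through to \<open>d\<close>. Folding over several lists
  therefore decides a disjunction of conjunctions.\<close>

primrec test_bits :: "(nat \<times> bool) list \<Rightarrow> decision \<Rightarrow> decision" where
  "test_bits [] d = Decide True"
| "test_bits (q # qs) d =
     (if snd q then Read (fst q) (test_bits qs d) d else Read (fst q) d (test_bits qs d))"

lemma outcome_test_bits:
  "outcome (test_bits qs d) \<phi> \<longleftrightarrow> (\<forall>(k, b) \<in> set qs. \<phi> k = b) \<or> outcome d \<phi>"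
  by (induction qs) auto

lemma positions_read_test_bits:
  "positions_read (test_bits qs d) \<phi> \<subseteq> fst ` set qs \<union> positions_read d \<phi>"
  by (induction qs) auto

lemma outcome_foldr_test_bits:
  "outcome (foldr (\<lambda>j. test_bits (q j)) js (Decide False)) \<phi> \<longleftrightarrow>
     (\<exists>j \<in> set js. \<forall>(k, b) \<in> set (q j). \<phi> k = b)"
  by (induction js) (auto simp: outcome_test_bits)

lemma positions_read_foldr_test_bits:
  "positions_read (foldr (\<lambda>j. test_bits (q j)) js (Decide False)) \<phi> \<subseteq>
     (\<Union>j \<in> set js. fst ` set (q j))"
proof (induction js)
  case (Cons j js)
  then show ?case
    using positions_read_test_bits[of "q j"] by fastforce
qed simp

lemma less_power_floorlog: "i < 2 ^ floorlog 2 i" for i :: nat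
  by (cases "i = 0") (auto simp: floorlog_bounds)

text \<open>Numbers below \<open>2 ^ L\<close> are determined by their lowest \<open>L\<close>
  bits.\<close>

lemma nat_eq_iff_low_bits:
  fixes a i :: nat
  assumes "i < 2 ^ L"
  shows "a = i \<longleftrightarrow> a < 2 ^ L \<and> (\<forall>t<L. bit a t = bit i t)"
proof
  assume R: "a < 2 ^ L \<and> (\<forall>t<L. bit a t = bit i t)"
  then have "take_bit L a = take_bit L i"
    by (auto simp: bit_eq_iff bit_take_bit_iff)
  with R assms show "a = i"
    by (simp add: take_bit_nat_eq_self)
qed (use assms in auto)

text \<open>Bit \<open>q\<close> of the code of the \<open>j\<close>-th position is stored at \<open>q * m + j\<close>.\<close>

definition position_code :: "nat \<Rightarrow> nat \<Rightarrow> bool" where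
  "position_code a q = (if even q then a < 2 ^ (q div 2) else bit a (q div 2))"

definition interleave :: "nat \<Rightarrow> (nat \<Rightarrow> nat) \<Rightarrow> advice" where
  "interleave m p k = position_code (p (k mod m)) (k div m)"

text \<open>\<open>floorlog 2 i\<close> is the number of binary digits of \<open>i\<close>, the
  least L with i < 2^L. The even code index asks the size test at L, the odd ones ask the L lowest
  digits.\<close>

definition queries :: "nat \<Rightarrow> nat \<Rightarrow> nat \<Rightarrow> (nat \<times> bool) list" where
  "queries m i j =
     (2 * floorlog 2 i * m + j, True) #
     map (\<lambda>t. ((2 * t + 1) * m + j, bit i t)) [0..<floorlog 2 i]"

lemma interleave_nth:
  assumes "j < m"
  shows "interleave m p (q * m + j) = position_code (p j) q"
proof -
  have "(q * m + j) mod m = j" "(q * m + j) div m = q"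
    using assms by auto
  then show ?thesis
    by (simp only: interleave_def)
qed

lemma queries_correct:
  assumes "j < m"
  shows "(\<forall>(k, b) \<in> set (queries m i j). interleave m p k = b) \<longleftrightarrow> p j = i"
proof -
  have "(\<forall>(k, b) \<in> set (queries m i j). interleave m p k = b) \<longleftrightarrow>
      position_code (p j) (2 * floorlog 2 i) \<and>
      (\<forall>t<floorlog 2 i. position_code (p j) (2 * t + 1) = bit i t)"
    unfolding queries_def
    by (simp add: interleave_nth[OF assms] image_iff ball_Un del: mult_Suc add_mult_distrib)
       (use interleave_nth[OF assms, of p] in auto)
  also have "\<dots> \<longleftrightarrow> p j = i"
    by (subst nat_eq_iff_low_bits[OF less_power_floorlog]) (simp add: position_code_def)
  finally show ?thesis .
qed

lemma queries_bound:
  assumes "j < m" "k \<in> fst ` set (queries m i j)"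
  shows "k < (2 * floorlog 2 i + 1) * m"
proof -
  consider "k = 2 * floorlog 2 i * m + j" | t where "t < floorlog 2 i" "k = (2 * t + 1) * m + j"
    using assms(2) by (auto simp: queries_def)
  then obtain q where q: "q \<le> 2 * floorlog 2 i" "k = q * m + j"
  proof cases
    case (2 t)
    then show thesis
      by (intro that[of "2 * t + 1"]) auto
  qed (use that in blast)
  \<comment> \<open>Since j < m, the address stays within the q-th block of length \<open>m\<close>;
    the last block touched is that of the size test.\<close>
  have "k < (q + 1) * m"
    using q assms(1) by simp
  also have "\<dots> \<le> (2 * floorlog 2 i + 1) * m"
    using q by (intro mult_right_mono) auto
  finally show ?thesis .
qed

section \<open>The algorithm\<close>

text \<open>\<open>input_length I - 1\<close> is the arrival index of the new vertex, counted from
  0. The edges are never consulted: the advice alone selects the solution.\<close>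

definition position_algorithm :: "nat \<Rightarrow> 'v algorithm" where
  "position_algorithm m I =
     foldr (\<lambda>j. test_bits (queries m (input_length I - 1) j)) [0..<m] (Decide False)"

lemma input_length_revealed:
  "i < input_length I \<Longrightarrow> input_length (revealed I (Suc i)) - 1 = i"
  by (simp add: input_length_def revealed_def)

lemma accepted_position_algorithm:
  "accepted (position_algorithm m) (interleave m p) I =
     {snd I ! i | i. i < input_length I \<and> (\<exists>j<m. p j = i)}"
proof -
  have "outcome (position_algorithm m (revealed I (Suc i))) (interleave m p) \<longleftrightarrow> (\<exists>j<m. p j = i)"
    if "i < input_length I" for i
    unfolding position_algorithm_def input_length_revealed[OF that] outcome_foldr_test_bits
    using queries_correct[of _ m i p] by auto
  then show ?thesis
    unfolding accepted_def by blast
qed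

lemma advice_read_position_algorithm:
  assumes "input_length I \<le> n"
  shows "advice_read (position_algorithm m) \<phi> I \<subseteq> {..<(2 * floorlog 2 n + 1) * m}"
proof -
  have "k < (2 * floorlog 2 n + 1) * m"
    if i: "i < input_length I"
      and k: "k \<in> positions_read (position_algorithm m (revealed I (Suc i))) \<phi>" for i k
  proof -
    have "k \<in> (\<Union>j\<in>set [0..<m]. fst ` set (queries m i j))"
      using k positions_read_foldr_test_bits
      unfolding position_algorithm_def input_length_revealed[OF i] by (rule rev_subsetD)
    then obtain j where "j < m" "k \<in> fst ` set (queries m i j)"
      by (metis UN_E atLeast_upt lessThan_iff)
    then have "k < (2 * floorlog 2 i + 1) * m"
      by (rule queries_bound)
    also have "\<dots> \<le> (2 * floorlog 2 n + 1) * m"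
      using i assms by (intro mult_right_mono add_mono mult_left_mono floorlog_mono) auto
    finally show ?thesis .
  qed
  then show ?thesis
    by (auto simp: advice_read_def)
qed

lemma position_algorithm_accepts:
  assumes I: "valid_input I" and W: "W \<subseteq> verts (fst I)" "card W \<le> m"
  obtains \<phi> where "accepted (position_algorithm m) \<phi> I = W"
proof -
  define P where "P = {i. i < input_length I \<and> snd I ! i \<in> W}"
  have d: "distinct (snd I)" and s: "set (snd I) = verts (fst I)"
    using I by (auto simp: valid_input_def)
  have img: "(!) (snd I) ` P = W"
    using W s by (force simp: P_def input_length_def in_set_conv_nth)
  \<comment> \<open>No vertex arrives twice, so \<open>P\<close> is as small as \<open>W\<close> and
    fits into \<open>m\<close> slots.\<close>
  have "inj_on ((!) (snd I)) P"
    using d by (auto simp: P_def input_length_def inj_on_nth)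
  then have "card P = card W"
    using img by (metis card_image)
  then obtain p where p: "\<And>i. i < input_length I \<Longrightarrow> i \<in> P \<longleftrightarrow> (\<exists>j<m. p j = i)"
    using enumerate_padded[of P "input_length I" m] W by (force simp: P_def)
  have "accepted (position_algorithm m) (interleave m p) I = (!) (snd I) ` P"
    unfolding accepted_position_algorithm using p by (auto simp: P_def)
  with img show thesis
    by (intro that) simp
qed

lemma floorlog_bigo: "(\<lambda>n. real ((2 * floorlog 2 n + 1) * m)) \<in> O(\<lambda>n. ln (real n))"
proof -
  \<comment> \<open>For n > 0, \<open>floorlog 2 n\<close> is at most log 2 n + 1, whence 3 = 2 * 1
    + 1.\<close>
  have "(\<lambda>n. real ((2 * floorlog 2 n + 1) * m)) \<in> O(\<lambda>n. (2 * log 2 (real n) + 3) * real m)"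
  proof (rule landau_o.big_mono, rule eventually_mono[OF eventually_gt_at_top[of 0]])
    fix n :: nat
    assume "0 < n"
    then have "0 \<le> log 2 (real n)"
      by simp
    then have "real (floorlog 2 n) \<le> log 2 (real n) + 1"
      using \<open>0 < n\<close> by (simp add: floorlog_def)
    then have "(2 * real (floorlog 2 n) + 1) * real m \<le> (2 * log 2 (real n) + 3) * real m"
      by (intro mult_right_mono) auto
    then show "norm (real ((2 * floorlog 2 n + 1) * m)) \<le> norm ((2 * log 2 (real n) + 3) * real m)"
      using \<open>0 \<le> log 2 (real n)\<close> by (simp add: abs_mult algebra_simps)
  qed
  also have "(\<lambda>n. (2 * log 2 (real n) + 3) * real m) \<in> O(\<lambda>n. ln (real n))"
    unfolding log_def by real_asymp
  finally show ?thesis .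
qed

theorem theorem12:
  fixes \<pi> :: "'v graph \<Rightarrow> bool"
  assumes "cohereditary \<pi>"
    and "\<exists>\<S>. finite \<S> \<and> obligatory_subgraphs \<S> \<pi>"
  shows "\<exists>(A :: 'v algorithm) (b :: nat \<Rightarrow> nat).
           (\<lambda>n. real (b n)) \<in> O(\<lambda>n. ln (real n)) \<and> optimal_with_advice \<pi> A b"
proof -
  obtain \<S> where S: "finite \<S>" "obligatory_subgraphs \<S> \<pi>"
    using assms(2) by blast
  \<comment> \<open>Finiteness of \<S> enters here: \<open>m\<close> depends on \<pi> only, not on
    the input, so it is a constant factor in the advice bound.\<close>
  obtain m where m: "\<And>H. H \<in> \<S> \<Longrightarrow> card (verts H) \<le> m"
    using S(1) finite_nat_set_iff_bounded_le[of "(\<lambda>H. card (verts H)) ` \<S>"] by auto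
  let ?b = "\<lambda>n. (2 * floorlog 2 n + 1) * m"
  have "optimal_with_advice \<pi> (position_algorithm m) ?b"
    unfolding optimal_with_advice_def
  proof (intro allI impI, elim conjE)
    fix n and I :: "'v online_input"
    assume I: "valid_input I" "input_length I \<le> n"
    then have "simple_graph (fst I)"
      by (simp add: valid_input_def)
    then obtain W where W: "W \<subseteq> verts (fst I)" "card W \<le> m"
      and opt: "min_cost \<pi> (fst I) W = opt_cost \<pi> (fst I)"
      using small_optimum[OF S(2) m] by blast
    obtain \<phi> where "accepted (position_algorithm m) \<phi> I = W"
      using position_algorithm_accepts[OF I(1) W] .
    with opt advice_read_position_algorithm[OF I(2)]
    show "\<exists>\<phi>. min_cost \<pi> (fst I) (accepted (position_algorithm m) \<phi> I) = opt_cost \<pi> (fst I) \<and>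
        advice_read (position_algorithm m) \<phi> I \<subseteq> {..<?b n}"
      by blast
  qed
  with floorlog_bigo[of m] show ?thesis
    by (intro exI[of _ "position_algorithm m"] exI[of _ ?b] conjI)
qed

end
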